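(* Let $(\xi(i))_{i\ge 1}$ be a sequence of (centered, integrable) martingale differences relative to some filtration $\{F(i)\}$, and let $T(\cdot)$ be a tail-function with $\int_0^\infty x^2\,|dT(x)|<\infty$ such that $T(\xi(i),x)\le T(x)$ for all $i$ and all $x\ge 0$. Then for every $n\ge 1$ and every $x\ge 2$, $$Q_n(x)\le W[T](x\sqrt n).$$
   Context: Let $(\Omega,F,\mathbf P)$ be a probability space with a filtration $F(0)=\{\emptyset,\Omega\}$, $F(i)\subset F(i+1)\subset F$. Random variables $\xi(i)$ are martingale differences relative to $\{F(i)\}$ if $\mathbf E|\xi(i)|<\infty$, $\mathbf E\,\xi(i)=0$, $\xi(i)$ is $F(i)$-measurable, and $\mathbf E[\xi(i)\mid F(k)]=0$ a.s. for all $k=0,1,\dots,i-1$. Put $S(n)=\sum_{i=1}^n\xi(i)$ and $Q_n(x)=\mathbf P(S(n)/n>x)$ for $x>0$. For a random variable $\xi$ the tail-function of $\xi$ is $T(\xi,x)=\max(\mathbf P(\xi\ge x),\mathbf P(\xi\le -x))$, $x\ge 0$. A (general) tail-function is a function $T:[0,\infty)\to[0,1]$ which is monotonically decreasing, right continuous, with $T(0)=1$ and $T(\infty)=\lim_{x\to\infty}T(x)=0$. For a tail-function $T$ with finite second moment $\int_0^\infty x^2\,|dT(x)|<\infty$ define $$W[T](x)=\min\left(1,\ \inf_{v>0}\left[\exp\left(-\frac{x^2}{8v^2}\right)-\int_v^\infty y^2\,dT(y)\right]\right).$$ *)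

theory Defs
  imports "HOL-Probability.Probability"
begin

text \<open>The sub-sigma-algebras are represented by measures \<open>F i\<close> on \<open>space M\<close>; only
  their measurable sets matter. The differences are indexed by \<open>i \<ge> 1\<close>, so the value \<open>\<xi> 0\<close>
  is never used.\<close>

definition martingale_differences ::
  "'a measure \<Rightarrow> (nat \<Rightarrow> 'a measure) \<Rightarrow> (nat \<Rightarrow> 'a \<Rightarrow> real) \<Rightarrow> bool" where
  "martingale_differences M F \<xi> \<longleftrightarrow>
     filtration (space M) F \<and>
     sets (F 0) = {{}, space M} \<and>
     (\<forall>i. subalgebra M (F i)) \<and>
     (\<forall>i\<ge>1. integrable M (\<xi> i) \<and>
             integral\<^sup>L M (\<xi> i) = 0 \<and>
             \<xi> i \<in> borel_measurable (F i) \<and>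
             (\<forall>k<i. AE \<omega> in M. real_cond_exp M (F k) (\<xi> i) \<omega> = 0))"

definition partial_sum :: "(nat \<Rightarrow> 'a \<Rightarrow> real) \<Rightarrow> nat \<Rightarrow> 'a \<Rightarrow> real" where
  "partial_sum \<xi> n \<omega> = (\<Sum>i=1..n. \<xi> i \<omega>)"

definition Q :: "'a measure \<Rightarrow> (nat \<Rightarrow> 'a \<Rightarrow> real) \<Rightarrow> nat \<Rightarrow> real \<Rightarrow> real" where
  "Q M \<xi> n x = measure M {\<omega> \<in> space M. partial_sum \<xi> n \<omega> / real n > x}"

definition tail_of :: "'a measure \<Rightarrow> ('a \<Rightarrow> real) \<Rightarrow> real \<Rightarrow> real" where
  "tail_of M X x =
     max (measure M {\<omega> \<in> space M. X \<omega> \<ge> x}) (measure M {\<omega> \<in> space M. X \<omega> \<le> - x})"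

text \<open>A function on \<open>[0, \<infinity>)\<close> is represented by a function on the reals whose values at
  negative arguments are irrelevant.\<close>

definition tail_function :: "(real \<Rightarrow> real) \<Rightarrow> bool" where
  "tail_function T \<longleftrightarrow>
     (\<forall>x\<ge>0. 0 \<le> T x \<and> T x \<le> 1) \<and>
     antimono_on {0..} T \<and>
     (\<forall>x\<ge>0. continuous (at_right x) T) \<and>
     T 0 = 1 \<and>
     (T \<longlongrightarrow> 0) at_top"

text \<open>The Lebesgue--Stieltjes measure \<open>|dT| = - dT\<close> on the half-line. Since \<open>T\<close> decreases,
  \<open>- T\<close> is a distribution function; it is continued by the constant \<open>- T 0\<close> to the left
  of \<open>0\<close>, so that the negative half-line is a null set.\<close>

definition abs_dT :: "(real \<Rightarrow> real) \<Rightarrow> real measure" where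
  "abs_dT T = interval_measure (\<lambda>x. - T (max 0 x))"

lemma emeasure_abs_dT:
  assumes "tail_function T" "0 \<le> a" "a \<le> b"
  shows "emeasure (abs_dT T) {a<..b} = ennreal (T a - T b)"
proof -
  have mono: "- T (max 0 x) \<le> - T (max 0 y)" if "x \<le> y" for x y
    using assms(1) that unfolding tail_function_def monotone_on_def by auto
  have cont: "continuous (at_right x) (\<lambda>x. - T (max 0 x))" for x
  proof (cases "x < 0")
    case True
    have "((\<lambda>y. - T (max 0 y)) \<longlongrightarrow> - T 0) (at_right x)"
      by (rule tendsto_eventually)
         (use True in \<open>auto simp: eventually_at_right_field max_def intro!: exI[of _ 0]\<close>)
    then show ?thesis using True by (simp add: continuous_within max_def)
  next
    case False
    then have "(T \<longlongrightarrow> T x) (at_right x)"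
      using assms(1) unfolding tail_function_def continuous_within by auto
    then have "((\<lambda>y. T (max 0 y)) \<longlongrightarrow> T x) (at_right x)"
      by (rule Lim_transform_eventually)
         (use False in \<open>auto simp: eventually_at_right_field max_def intro!: exI[of _ "x + 1"]\<close>)
    then show ?thesis using False by (auto simp: continuous_within max_def intro!: tendsto_minus)
  qed
  show ?thesis
    unfolding abs_dT_def
    using emeasure_interval_measure_Ioc[of a b "\<lambda>x. - T (max 0 x)"] assms mono cont
    by simp
qed

definition finite_second_moment :: "(real \<Rightarrow> real) \<Rightarrow> bool" where
  "finite_second_moment T \<longleftrightarrow> set_integrable (abs_dT T) {0..} (\<lambda>y. y\<^sup>2)"

text \<open>The term \<open>- \<integral>\<^sub>v\<^sup>\<infinity> y\<^sup>2 dT(y)\<close> is the integral of \<open>y\<^sup>2\<close> against \<open>- dT\<close>. Whether a jump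
  of \<open>T\<close> at \<open>v\<close> itself is counted does not affect the infimum over \<open>v\<close>.\<close>

definition W :: "(real \<Rightarrow> real) \<Rightarrow> real \<Rightarrow> real" where
  "W T x =
     min 1 (INF v\<in>{0<..}. exp (- (x\<^sup>2 / (8 * v\<^sup>2))) + (LINT y:{v<..}|abs_dT T. y\<^sup>2))"

end

theory Submission
  imports Defs
begin

text \<open>Fix the truncation level \<open>v\<close> and write each difference as the truncated part minus its
  conditional mean, plus a remainder that is again a martingale difference. The first sum has
  conditionally bounded increments and Hoeffding's lemma yields the exponential term with deviation
  \<open>n x / 2\<close>. The remainders are orthogonal, and their second moments are at most
  \<open>2 \<integral>\<^sub>v\<^sup>\<infinity> y\<^sup>2 |dT|\<close>, the factor 2 coming from the two tails; Chebyshev's inequality divides this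
  by \<open>n x\<^sup>2 / 4 \<ge> n\<close>, which absorbs the factor 2 as soon as \<open>n \<ge> 2\<close>. For \<open>n = 1\<close> one tail suffices:
  the right tail if \<open>v \<le> x\<close>, and otherwise the left tail, since a centred variable that is
  very likely to exceed \<open>x\<close> must have a large second moment on its left tail.\<close>

section \<open>Integrals compared through superlevel sets\<close>

text \<open>Tonelli for the region under the graph of \<open>f\<close>: the section over
  \<open>x\<close> has length \<open>max 0 (f x)\<close>, which is what \<open>ennreal (f x)\<close>
  records, and the section at height \<open>t\<close> is the superlevel set.\<close>

lemma (in sigma_finite_measure) nn_integral_layer_cake:
  fixes f :: "'a \<Rightarrow> real"
  assumes [measurable]: "f \<in> borel_measurable M"
  shows "(\<integral>\<^sup>+x. ennreal (f x) \<partial>M) =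
    (\<integral>\<^sup>+t. indicator {0..} t * emeasure M {x \<in> space M. t < f x} \<partial>lborel)"
proof -
  interpret P: pair_sigma_finite M "lborel :: real measure" ..
  have "(\<integral>\<^sup>+x. ennreal (f x) \<partial>M)
      = (\<integral>\<^sup>+x. (\<integral>\<^sup>+t. indicator {(x, t). 0 \<le> t \<and> t < f x} (x, t) \<partial>lborel) \<partial>M)"
  proof (rule nn_integral_cong)
    fix x
    have "(\<integral>\<^sup>+t. indicator {(x, t). 0 \<le> t \<and> t < f x} (x, t) \<partial>lborel)
        = (\<integral>\<^sup>+t. indicator {0..<f x} t \<partial>lborel)"
      by (intro nn_integral_cong) (auto split: split_indicator)
    also have "\<dots> = ennreal (f x)"
      by (cases "0 \<le> f x") (auto simp: ennreal_neg)
    finally show "ennreal (f x) =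
      (\<integral>\<^sup>+t. indicator {(x, t). 0 \<le> t \<and> t < f x} (x, t) \<partial>lborel)" by simp
  qed
  also have "\<dots> = (\<integral>\<^sup>+t. (\<integral>\<^sup>+x. indicator {(x, t). 0 \<le> t \<and> t < f x} (x, t) \<partial>M) \<partial>lborel)"
    by (rule P.Fubini'[symmetric]) measurable
  also have "\<dots> = (\<integral>\<^sup>+t. indicator {0..} t * emeasure M {x \<in> space M. t < f x} \<partial>lborel)"
  proof (rule nn_integral_cong)
    fix t
    have "(\<integral>\<^sup>+x. indicator {(x, t). 0 \<le> t \<and> t < f x} (x, t) \<partial>M)
        = (\<integral>\<^sup>+x. indicator {0..} t * indicator {x \<in> space M. t < f x} x \<partial>M)"
      by (intro nn_integral_cong) (auto split: split_indicator)
    also have "\<dots> = indicator {0..} t * emeasure M {x \<in> space M. t < f x}"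
      by (subst nn_integral_cmult) auto
    finally show "(\<integral>\<^sup>+x. indicator {(x, t). 0 \<le> t \<and> t < f x} (x, t) \<partial>M)
        = indicator {0..} t * emeasure M {x \<in> space M. t < f x}" .
  qed
  finally show ?thesis .
qed

text \<open>By the layer-cake formula each integral depends only on the masses of the superlevel
  sets at heights \<open>t \<ge> 0\<close>. Later \<open>M\<close> carries a random variable and
  \<open>N\<close> a restriction of \<open>abs_dT T\<close>.\<close>

lemma nn_integral_mono_stochastic_order:
  fixes f :: "'a \<Rightarrow> real" and g :: "'b \<Rightarrow> real"
  assumes "sigma_finite_measure M" "sigma_finite_measure N"
    and "f \<in> borel_measurable M" "g \<in> borel_measurable N"
    and "\<And>t. 0 \<le> t \<Longrightarrow> emeasure M {x \<in> space M. t < f x} \<le> emeasure N {x \<in> space N. t < g x}"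
  shows "(\<integral>\<^sup>+x. ennreal (f x) \<partial>M) \<le> (\<integral>\<^sup>+x. ennreal (g x) \<partial>N)"
  unfolding sigma_finite_measure.nn_integral_layer_cake[OF assms(1,3)]
    sigma_finite_measure.nn_integral_layer_cake[OF assms(2,4)]
  by (intro nn_integral_mono) (auto split: split_indicator intro: assms(5))

section \<open>The measure \<open>abs_dT T\<close> and second moments beyond a level\<close>

lemma space_abs_dT [simp]: "space (abs_dT T) = UNIV"
  and sets_abs_dT [measurable_cong]: "sets (abs_dT T) = sets borel"
  by (simp_all add: abs_dT_def)

text \<open>The mass of \<open>{c<..c + real k}\<close> is \<open>T c - T (c + real k)\<close>, and
  the subtracted term tends to \<open>0\<close> because a tail-function vanishes at
  infinity.\<close>

lemma emeasure_abs_dT_greaterThan: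
  assumes T: "tail_function T" and c: "0 \<le> c"
  shows "emeasure (abs_dT T) {c<..} = ennreal (T c)"
proof -
  have "(\<lambda>k. emeasure (abs_dT T) {c<..c + real k})
      \<longlonglongrightarrow> emeasure (abs_dT T) (\<Union>k. {c<..c + real k})"
    by (intro Lim_emeasure_incseq) (auto simp: incseq_def sets_abs_dT)
  moreover have "(\<Union>k. {c<..c + real k}) = {c<..}"
  proof -
    have "\<exists>k. y \<le> c + real k" for y
      using real_arch_simple[of "y - c"] by (auto simp: algebra_simps)
    then show ?thesis by auto
  qed
  ultimately have "(\<lambda>k. emeasure (abs_dT T) {c<..c + real k}) \<longlonglongrightarrow> emeasure (abs_dT T) {c<..}"
    by simp
  moreover have "(\<lambda>k. emeasure (abs_dT T) {c<..c + real k}) \<longlonglongrightarrow> ennreal (T c - 0)"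
  proof -
    have "filterlim (\<lambda>k. c + real k) at_top sequentially"
      by (intro filterlim_tendsto_add_at_top[OF tendsto_const] filterlim_real_sequentially)
    moreover have "(T \<longlongrightarrow> 0) at_top"
      using T by (simp add: tail_function_def)
    ultimately have "(\<lambda>k. T (c + real k)) \<longlonglongrightarrow> 0"
      by (rule filterlim_compose[rotated])
    then have "(\<lambda>k. ennreal (T c - T (c + real k))) \<longlonglongrightarrow> ennreal (T c - 0)"
      by (intro tendsto_ennrealI tendsto_diff tendsto_const)
    then show ?thesis
      using c by (simp add: emeasure_abs_dT[OF T])
  qed
  ultimately show ?thesis
    using LIMSEQ_unique by fastforce
qed

text \<open>The superlevel sets of \<open>y\<^sup>2\<close> restricted to \<open>y > v\<close> are
  half-lines \<open>{c<..}\<close>; on these the law of \<open>X\<close> has mass at most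
  \<open>T c\<close>, which is the mass under \<open>abs_dT T\<close>. Being about the right tail,
  the lemma serves for a difference and for its negative alike.\<close>

lemma (in prob_space) second_moment_tail:
  fixes X :: "'a \<Rightarrow> real"
  assumes X [measurable]: "X \<in> borel_measurable M"
    and T: "tail_function T" "finite_second_moment T"
    and v: "0 < v"
    and tail: "\<And>y. 0 \<le> y \<Longrightarrow> prob {\<omega> \<in> space M. X \<omega> \<ge> y} \<le> T y"
  shows "integrable M (\<lambda>\<omega>. if v < X \<omega> then (X \<omega>)\<^sup>2 else 0)" (is ?int)
    and "expectation (\<lambda>\<omega>. if v < X \<omega> then (X \<omega>)\<^sup>2 else 0) \<le> (LINT y:{v<..}|abs_dT T. y\<^sup>2)" (is ?le)
proof -
  \<comment> \<open>On the positive half-line \<open>abs_dT T\<close> has mass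
    \<open>T 0 = 1\<close>, so \<open>N\<close> is a probability measure; as \<open>g\<close>
    vanishes up to \<open>v > 0\<close>, its integral is the same as over the whole line.\<close>
  define N where "N = restrict_space (abs_dT T) {0<..}"
  define g where "g y = (if v < y then y\<^sup>2 else 0)" for y :: real
  have g [measurable]: "g \<in> borel_measurable borel"
    unfolding g_def by measurable
  have N_space: "space N = {0<..}" and N_sets: "sets N = sets (restrict_space borel {0<..})"
    by (auto simp: N_def space_restrict_space sets_abs_dT intro!: sets_restrict_space_cong)
  have "emeasure N (space N) = 1"
    using emeasure_abs_dT_greaterThan[OF T(1), of 0] T(1)
    by (simp add: N_space) (simp add: N_def emeasure_restrict_space sets_abs_dT tail_function_def)
  then interpret N: prob_space N
    by (rule prob_spaceI)
  have gN: "g \<in> borel_measurable N"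
    unfolding N_def by (intro measurable_restrict_space1) measurable
  \<comment> \<open>The inequality \<open>t < y\<^sup>2\<close> alone would also admit negative
    \<open>y\<close>; together with \<open>0 < v < y\<close> it describes a right half-line.\<close>
  have level: "t < g y \<longleftrightarrow> max v (sqrt t) < y" if "0 \<le> t" for t y
    using that v real_sqrt_less_iff[of t "y\<^sup>2"] by (auto simp: g_def)
  have "(\<integral>\<^sup>+\<omega>. ennreal (g (X \<omega>)) \<partial>M) \<le> (\<integral>\<^sup>+y. ennreal (g y) \<partial>N)"
  proof (rule nn_integral_mono_stochastic_order)
    fix t :: real assume t: "0 \<le> t"
    define c where "c = max v (sqrt t)"
    have c: "0 < c" using v by (simp add: c_def)
    have "emeasure M {\<omega> \<in> space M. t < g (X \<omega>)} = emeasure M {\<omega> \<in> space M. c < X \<omega>}"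
      using t by (simp add: level c_def)
    also have "\<dots> \<le> emeasure M {\<omega> \<in> space M. c \<le> X \<omega>}"
      by (intro emeasure_mono) auto
    also have "\<dots> \<le> ennreal (T c)"
      using tail[of c] c by (simp add: emeasure_eq_measure ennreal_leI)
    also have "\<dots> = emeasure N {c<..}"
      using c by (simp add: N_def emeasure_restrict_space sets_abs_dT
          emeasure_abs_dT_greaterThan[OF T(1)])
    also have "{c<..} = {y \<in> space N. t < g y}"
      using t c by (auto simp: level c_def N_space)
    finally show "emeasure M {\<omega> \<in> space M. t < g (X \<omega>)} \<le> emeasure N {y \<in> space N. t < g y}" .
  qed (use gN in \<open>auto intro: sigma_finite_measure_axioms N.sigma_finite_measure_axioms\<close>)
  also have "\<dots> = (\<integral>\<^sup>+y. ennreal (indicator {v<..} y * y\<^sup>2) \<partial>abs_dT T)"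
    unfolding N_def
    by (subst nn_integral_restrict_space)
       (use v in \<open>auto simp: sets_abs_dT g_def intro!: nn_integral_cong split: split_indicator\<close>)
  also have "\<dots> = ennreal (LINT y:{v<..}|abs_dT T. y\<^sup>2)"
  proof -
    have "set_integrable (abs_dT T) {v<..} (\<lambda>y. y\<^sup>2)"
      using T(2) v unfolding finite_second_moment_def
      by (elim set_integrable_subset) (auto simp: sets_abs_dT)
    then show ?thesis
      unfolding set_integrable_def set_lebesgue_integral_def
      by (subst nn_integral_eq_integral[symmetric]) auto
  qed
  finally have le: "(\<integral>\<^sup>+\<omega>. ennreal (g (X \<omega>)) \<partial>M) \<le> ennreal (LINT y:{v<..}|abs_dT T. y\<^sup>2)" .
  have "integrable M (\<lambda>\<omega>. g (X \<omega>))"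
    using le by (intro integrableI_nonneg) (auto simp: g_def order_le_less_trans)
  then show ?int by (simp add: g_def)
  have "0 \<le> (LINT y:{v<..}|abs_dT T. y\<^sup>2)"
    unfolding set_lebesgue_integral_def by (intro Bochner_Integration.integral_nonneg) auto
  moreover have "ennreal (expectation (\<lambda>\<omega>. g (X \<omega>))) = (\<integral>\<^sup>+\<omega>. ennreal (g (X \<omega>)) \<partial>M)"
    using \<open>integrable M (\<lambda>\<omega>. g (X \<omega>))\<close>
    by (intro nn_integral_eq_integral[symmetric]) (auto simp: g_def)
  ultimately have "expectation (\<lambda>\<omega>. g (X \<omega>)) \<le> (LINT y:{v<..}|abs_dT T. y\<^sup>2)"
    using le by (metis ennreal_le_iff)
  then show ?le by (simp add: g_def)
qed

section \<open>Hoeffding's lemma for two-point distributions\<close>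

text \<open>The left-hand side is the exponential moment of \<open>Z - c\<close>, where \<open>Z\<close> takes the values
  \<open>v\<close> and \<open>- v\<close> and has mean \<open>c\<close>.\<close>

lemma two_point_exp_moment_le:
  fixes c l v :: real
  assumes v: "0 < v" and l: "0 \<le> l" and c: "\<bar>c\<bar> \<le> v"
  shows "exp (- l * c) * ((v - c) / (2 * v) * exp (- l * v) + (v + c) / (2 * v) * exp (l * v))
    \<le> exp (l\<^sup>2 * v\<^sup>2 / 2)"
proof -
  \<comment> \<open>\<open>p\<close> is the weight of the value \<open>v\<close>, and
    \<open>h\<close> the length of the interval from \<open>- l * v\<close> to \<open>l * v\<close>.
    In these variables the logarithm of the left-hand side takes the form bounded by
    \<open>Hoeffdings_lemma_aux\<close>.\<close>
  define p h where "p = (v + c) / (2 * v)" and "h = 2 * l * v"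
  have p: "0 \<le> p" using v c by (simp add: p_def)
  have h: "0 \<le> h" using v l by (simp add: h_def)
  have q: "(v - c) / (2 * v) = 1 - p" using v by (simp add: p_def field_simps)
  have hp: "h * p = l * v + l * c" using v by (simp add: p_def h_def field_simps)
  have pos: "0 < 1 + p * (exp h - 1)"
    using p h by (intro add_pos_nonneg mult_nonneg_nonneg) auto
  have eh: "exp h = exp (l * v) * exp (l * v)"
    by (simp add: h_def flip: exp_add)
  have inv: "exp (- l * v) * exp (l * v) = 1"
    by (simp flip: exp_add)
  have "exp (- l * c) * ((1 - p) * exp (- l * v) + p * exp (l * v))
      = exp (- l * c) * (exp (- l * v) * (1 + p * (exp h - 1)))"
    using inv unfolding eh by algebra
  also have "\<dots> = exp (- h * p) * exp (ln (1 + p * (exp h - 1)))"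
    using pos hp by (simp add: exp_add[symmetric] algebra_simps)
  also have "\<dots> = exp (- h * p + ln (1 + p * (exp h - 1)))"
    by (simp only: exp_add)
  also have "\<dots> \<le> exp (h\<^sup>2 / 8)"
    using Hoeffdings_lemma_aux[OF h p] by (simp only: exp_le_cancel_iff)
  also have "h\<^sup>2 / 8 = l\<^sup>2 * v\<^sup>2 / 2"
    by (simp add: h_def power_mult_distrib)
  finally show ?thesis unfolding q p_def[symmetric] .
qed

text \<open>Convexity of the exponential, with the barycentric coordinates of \<open>a\<close> in
  \<open>[- v, v]\<close> as weights. The chord is affine in \<open>a\<close>, so conditional
  expectations pass through it.\<close>

lemma exp_le_chord:
  fixes a l v :: real
  assumes v: "0 < v" and l: "0 \<le> l" and a: "\<bar>a\<bar> \<le> v"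
  shows "exp (l * a) \<le> (v - a) / (2 * v) * exp (- l * v) + (v + a) / (2 * v) * exp (l * v)"
proof -
  define t where "t = (v + a) / (2 * v)"
  have t: "0 \<le> t" "t \<le> 1" using v a by (auto simp: t_def field_simps)
  have q: "(v - a) / (2 * v) = 1 - t" using v by (simp add: t_def field_simps)
  have "exp (l * ((1 - t) *\<^sub>R (- v) + t *\<^sub>R v)) \<le> (1 - t) * exp (l * (- v)) + t * exp (l * v)"
    using t l by (intro convex_onD[OF convex_on_exp]) auto
  moreover have "(1 - t) *\<^sub>R (- v) + t *\<^sub>R v = a"
    using v by (simp add: t_def field_simps)
  ultimately show ?thesis unfolding q t_def[symmetric] by simp
qed

section \<open>Exponential moments of compensated sums\<close>

text \<open>The conditional expectation of \<open>a\<close> obeys the bound almost everywhere;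
  clipping it to \<open>[- v, v]\<close> changes it only on a null set and makes the bound
  pointwise. It is passed on through its identity against test functions, the form in which later
  steps use it.\<close>

lemma (in prob_space) bounded_cond_exp_version:
  fixes a :: "'a \<Rightarrow> real"
  assumes G: "subalgebra M G" and a [measurable]: "a \<in> borel_measurable M"
    and bound: "\<And>\<omega>. \<bar>a \<omega>\<bar> \<le> v"
  obtains c where "c \<in> borel_measurable G" "\<And>\<omega>. \<bar>c \<omega>\<bar> \<le> v"
    and "\<And>f. f \<in> borel_measurable G \<Longrightarrow> integrable M f \<Longrightarrow>
      expectation (\<lambda>\<omega>. f \<omega> * a \<omega>) = expectation (\<lambda>\<omega>. f \<omega> * c \<omega>)"
proof -
  interpret finite_measure_subalgebra M G
    by unfold_locales (rule G)
  define e where "e = real_cond_exp M G a"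
  define c where "c \<omega> = max (- v) (min v (e \<omega>))" for \<omega>
  have v: "0 \<le> v" using bound[of undefined] by linarith
  have int_a: "integrable M a"
    by (rule integrable_const_bound[where B = v]) (use bound in auto)
  have "AE \<omega> in M. e \<omega> \<ge> - v" "AE \<omega> in M. e \<omega> \<le> v"
    unfolding e_def using bound
    by (auto intro!: real_cond_exp_ge_c real_cond_exp_le_c int_a simp: abs_le_iff minus_le_iff)
  then have ae: "AE \<omega> in M. e \<omega> = c \<omega>"
    by eventually_elim (auto simp: c_def)
  have e [measurable]: "e \<in> borel_measurable G"
    by (simp add: e_def)
  have c [measurable]: "c \<in> borel_measurable G"
    unfolding c_def by measurable
  show thesis
  proof (rule that[of c])
    show "\<bar>c \<omega>\<bar> \<le> v" for \<omega>
      using v by (auto simp: c_def)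
    fix f :: "'a \<Rightarrow> real"
    assume f [measurable]: "f \<in> borel_measurable G" and int_f: "integrable M f"
    have [measurable]: "f \<in> borel_measurable M" "c \<in> borel_measurable M" "e \<in> borel_measurable M"
      by (rule measurable_from_subalg[OF G], fact)+
    have "integrable M (\<lambda>\<omega>. f \<omega> * a \<omega>)"
      by (rule Bochner_Integration.integrable_bound[OF integrable_mult_left[OF int_f, of v]])
         (use bound v in \<open>auto simp: abs_mult intro!: mult_left_mono\<close>)
    from real_cond_exp_intg(2)[OF this f a]
    have "expectation (\<lambda>\<omega>. f \<omega> * a \<omega>) = expectation (\<lambda>\<omega>. f \<omega> * e \<omega>)"
      by (simp add: e_def)
    also have "\<dots> = expectation (\<lambda>\<omega>. f \<omega> * c \<omega>)"
      by (intro integral_cong_AE) (use ae in auto)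
    finally show "expectation (\<lambda>\<omega>. f \<omega> * a \<omega>) = expectation (\<lambda>\<omega>. f \<omega> * c \<omega>)" .
  qed (fact c)
qed

text \<open>Each step costs at most the factor \<open>exp (l\<^sup>2 * v\<^sup>2 / 2)\<close> of
  Hoeffding's lemma. The index shift matters: \<open>a i\<close> is known at time
  \<open>i + 1\<close>, its compensator \<open>c i\<close> already at time \<open>i\<close>, so the
  sum of the first \<open>k\<close> terms is known at time \<open>k\<close>.\<close>

lemma (in prob_space) exp_moment_compensated_sum_le:
  fixes a c :: "nat \<Rightarrow> 'a \<Rightarrow> real"
  assumes sub: "\<And>i. subalgebra M (F i)" and mono: "\<And>i j. i \<le> j \<Longrightarrow> subalgebra (F j) (F i)"
    and v: "0 < v" and l: "0 \<le> l"
    and a: "\<And>i. a i \<in> borel_measurable (F (Suc i))" "\<And>i \<omega>. \<bar>a i \<omega>\<bar> \<le> v"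
    and c: "\<And>i. c i \<in> borel_measurable (F i)" "\<And>i \<omega>. \<bar>c i \<omega>\<bar> \<le> v"
    and comp: "\<And>i f. f \<in> borel_measurable (F i) \<Longrightarrow> integrable M f \<Longrightarrow>
      expectation (\<lambda>\<omega>. f \<omega> * a i \<omega>) = expectation (\<lambda>\<omega>. f \<omega> * c i \<omega>)"
  shows "integrable M (\<lambda>\<omega>. exp (l * (\<Sum>i<n. a i \<omega> - c i \<omega>)))"
    and "expectation (\<lambda>\<omega>. exp (l * (\<Sum>i<n. a i \<omega> - c i \<omega>))) \<le> exp (real n * (l\<^sup>2 * v\<^sup>2 / 2))"
proof -
  define S where "S k \<omega> = (\<Sum>i<k. a i \<omega> - c i \<omega>)" for k \<omega>
  have S_meas: "S k \<in> borel_measurable (F k)" for k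
    unfolding S_def
    by (intro borel_measurable_sum borel_measurable_diff)
       (auto intro: measurable_from_subalg[OF mono a(1)] measurable_from_subalg[OF mono c(1)])
  have [measurable]: "S k \<in> borel_measurable M" "a k \<in> borel_measurable M"
    "c k \<in> borel_measurable M" for k
    using measurable_from_subalg[OF sub] S_meas a(1) c(1) by blast+
  \<comment> \<open>A crude bound that serves to make the exponentials integrable.\<close>
  have S_bound: "\<bar>S k \<omega>\<bar> \<le> real k * (2 * v)" for k \<omega>
  proof -
    have "\<bar>S k \<omega>\<bar> \<le> (\<Sum>i<k. \<bar>a i \<omega> - c i \<omega>\<bar>)" unfolding S_def by (rule sum_abs)
    also have "\<dots> \<le> (\<Sum>i<k. 2 * v)"
    proof (rule sum_mono)
      fix i show "\<bar>a i \<omega> - c i \<omega>\<bar> \<le> 2 * v" using a(2)[of i \<omega>] c(2)[of i \<omega>] by linarith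
    qed
    finally show ?thesis by simp
  qed
  have int: "integrable M (\<lambda>\<omega>. exp (l * S k \<omega>))" for k
  proof (rule integrable_const_bound[where B = "exp (l * (real k * (2 * v)))"])
    show "AE \<omega> in M. norm (exp (l * S k \<omega>)) \<le> exp (l * (real k * (2 * v)))"
      using S_bound l by (auto intro!: mult_left_mono simp: abs_le_iff)
  qed simp
  then show "integrable M (\<lambda>\<omega>. exp (l * (\<Sum>i<n. a i \<omega> - c i \<omega>)))"
    by (simp add: S_def)
  have "expectation (\<lambda>\<omega>. exp (l * S n \<omega>)) \<le> exp (real n * (l\<^sup>2 * v\<^sup>2 / 2))"
  proof (induction n)
    case 0
    show ?case by (simp add: S_def prob_space)
  next
    case (Suc k)
    define U where "U \<omega> = exp (l * S k \<omega>) * exp (- l * c k \<omega>)" for \<omega>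
    \<comment> \<open>The chord of the exponential over \<open>[- v, v]\<close> is affine in \<open>a k\<close>, so \<open>comp\<close> replaces \<open>a k\<close> by \<open>c k\<close>.\<close>
    define A B where "A = (exp (- l * v) + exp (l * v)) / 2"
      and "B = (exp (l * v) - exp (- l * v)) / (2 * v)"
    have chord: "(v - y) / (2 * v) * exp (- l * v) + (v + y) / (2 * v) * exp (l * v) = A + B * y"
      for y using v by (simp add: A_def B_def field_simps)
    \<comment> \<open>\<open>c k\<close> belongs to the past too, so \<open>U\<close> is an
      admissible test function for \<open>comp\<close>; what remains of the next exponential is
      \<open>exp (l * a k \<omega>)\<close>.\<close>
    have UF: "U \<in> borel_measurable (F k)"
      unfolding U_def using S_meas[of k] c(1)[of k] by measurable
    have [measurable]: "U \<in> borel_measurable M"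
      unfolding U_def by measurable
    have Upos: "0 \<le> U \<omega>" for \<omega> by (simp add: U_def)
    have Ule: "U \<omega> \<le> exp (l * v) * exp (l * S k \<omega>)" for \<omega>
    proof -
      have "- c k \<omega> \<le> v" using c(2)[of k \<omega>] by linarith
      then have "l * (- c k \<omega>) \<le> l * v" using l by (rule mult_left_mono)
      then show ?thesis by (simp add: U_def mult.commute)
    qed
    have intU: "integrable M U"
      by (rule Bochner_Integration.integrable_bound[OF integrable_mult_right[OF int[of k], of "exp (l * v)"]])
         (use Upos Ule in auto)
    have intUy: "integrable M (\<lambda>\<omega>. U \<omega> * y \<omega>)"
      if "y \<in> borel_measurable M" "\<And>\<omega>. \<bar>y \<omega>\<bar> \<le> v" for y
      by (rule Bochner_Integration.integrable_bound[OF integrable_mult_left[OF intU, of v]])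
         (use that v in \<open>auto simp: abs_mult intro!: mult_left_mono\<close>)
    have intA: "integrable M (\<lambda>\<omega>. U \<omega> * (A + B * a k \<omega>))"
      and intC: "integrable M (\<lambda>\<omega>. U \<omega> * (A + B * c k \<omega>))"
      using intUy[of "a k"] intUy[of "c k"] a(2) c(2) intU
      by (auto simp: distrib_left mult.left_commute)
    have "expectation (\<lambda>\<omega>. exp (l * S (Suc k) \<omega>)) \<le> expectation (\<lambda>\<omega>. U \<omega> * (A + B * a k \<omega>))"
    proof (rule integral_mono[OF int intA])
      fix \<omega>
      have "exp (l * S (Suc k) \<omega>) = U \<omega> * exp (l * a k \<omega>)"
        by (simp add: U_def S_def algebra_simps flip: exp_add)
      also have "\<dots> \<le> U \<omega> * (A + B * a k \<omega>)"
        using exp_le_chord[OF v l a(2)[of k \<omega>]] Upos unfolding chord by (rule mult_left_mono)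
      finally show "exp (l * S (Suc k) \<omega>) \<le> U \<omega> * (A + B * a k \<omega>)" .
    qed
    also have "\<dots> = A * expectation U + B * expectation (\<lambda>\<omega>. U \<omega> * a k \<omega>)"
      using intUy[of "a k"] a(2) intU by (simp add: distrib_left mult.left_commute mult.commute[of _ A])
    also have "\<dots> = A * expectation U + B * expectation (\<lambda>\<omega>. U \<omega> * c k \<omega>)"
      using comp[OF UF intU] by simp
    also have "\<dots> = expectation (\<lambda>\<omega>. U \<omega> * (A + B * c k \<omega>))"
      using intUy[of "c k"] c(2) intU by (simp add: distrib_left mult.left_commute mult.commute[of _ A])
    \<comment> \<open>With \<open>c k\<close> in place of \<open>a k\<close>, the chord times
      \<open>exp (- l * c k \<omega>)\<close> is the two-point moment, which is bounded at every
      point.\<close>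
    also have "\<dots> \<le> expectation (\<lambda>\<omega>. exp (l * S k \<omega>) * exp (l\<^sup>2 * v\<^sup>2 / 2))"
    proof (rule integral_mono[OF intC])
      fix \<omega>
      have "exp (- l * c k \<omega>) * (A + B * c k \<omega>) \<le> exp (l\<^sup>2 * v\<^sup>2 / 2)"
        using two_point_exp_moment_le[OF v l c(2)[of k \<omega>]] unfolding chord .
      then show "U \<omega> * (A + B * c k \<omega>) \<le> exp (l * S k \<omega>) * exp (l\<^sup>2 * v\<^sup>2 / 2)"
        by (simp add: U_def mult.assoc)
    qed (use int in simp)
    also have "\<dots> \<le> exp (real k * (l\<^sup>2 * v\<^sup>2 / 2)) * exp (l\<^sup>2 * v\<^sup>2 / 2)"
      using Suc by simp
    also have "\<dots> = exp (real (Suc k) * (l\<^sup>2 * v\<^sup>2 / 2))"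
      by (simp add: algebra_simps flip: exp_add)
    finally show ?case .
  qed
  then show "expectation (\<lambda>\<omega>. exp (l * (\<Sum>i<n. a i \<omega> - c i \<omega>))) \<le> exp (real n * (l\<^sup>2 * v\<^sup>2 / 2))"
    by (simp add: S_def)
qed

section \<open>Orthogonality and second moments\<close>

lemma integrable_mult_square_integrable:
  fixes f g :: "'a \<Rightarrow> real"
  assumes [measurable]: "f \<in> borel_measurable M" "g \<in> borel_measurable M"
    and "integrable M (\<lambda>x. (f x)\<^sup>2)" "integrable M (\<lambda>x. (g x)\<^sup>2)"
  shows "integrable M (\<lambda>x. f x * g x)"
proof (rule Bochner_Integration.integrable_bound[OF Bochner_Integration.integrable_add[OF assms(3,4)]])
  have "\<bar>f x * g x\<bar> \<le> (f x)\<^sup>2 + (g x)\<^sup>2" for x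
    using sum_squares_bound[of "\<bar>f x\<bar>" "\<bar>g x\<bar>"] by (simp add: abs_mult)
      (metis abs_ge_zero mult_nonneg_nonneg mult.assoc mult_2 add_increasing2 order_trans order_refl)
  then show "AE x in M. norm (f x * g x) \<le> norm ((f x)\<^sup>2 + (g x)\<^sup>2)" by simp
qed simp

lemma integrable_add_square:
  fixes f g :: "'a \<Rightarrow> real"
  assumes "f \<in> borel_measurable M" "g \<in> borel_measurable M"
    and "integrable M (\<lambda>x. (f x)\<^sup>2)" "integrable M (\<lambda>x. (g x)\<^sup>2)"
  shows "integrable M (\<lambda>x. (f x + g x)\<^sup>2)"
  using assms integrable_mult_square_integrable[OF assms]
  by (simp add: power2_sum mult.assoc)

text \<open>When the square of the next partial sum is expanded, the cross term vanishes: the sum so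
  far is \<open>F k\<close>-measurable and square integrable, hence orthogonal to
  \<open>z k\<close>.\<close>

lemma (in prob_space) second_moment_martingale_sum:
  fixes z :: "nat \<Rightarrow> 'a \<Rightarrow> real"
  assumes sub: "\<And>i. subalgebra M (F i)" and mono: "\<And>i j. i \<le> j \<Longrightarrow> subalgebra (F j) (F i)"
    and z: "\<And>i. z i \<in> borel_measurable (F (Suc i))" "\<And>i. integrable M (\<lambda>\<omega>. (z i \<omega>)\<^sup>2)"
    and orth: "\<And>i f. f \<in> borel_measurable (F i) \<Longrightarrow> integrable M (\<lambda>\<omega>. (f \<omega>)\<^sup>2) \<Longrightarrow>
      expectation (\<lambda>\<omega>. f \<omega> * z i \<omega>) = 0"
  shows "integrable M (\<lambda>\<omega>. (\<Sum>i<n. z i \<omega>)\<^sup>2)"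
    and "expectation (\<lambda>\<omega>. (\<Sum>i<n. z i \<omega>)\<^sup>2) = (\<Sum>i<n. expectation (\<lambda>\<omega>. (z i \<omega>)\<^sup>2))"
proof -
  define S where "S k \<omega> = (\<Sum>i<k. z i \<omega>)" for k \<omega>
  have S_meas: "S k \<in> borel_measurable (F k)" for k
    unfolding S_def
    by (intro borel_measurable_sum) (auto intro: measurable_from_subalg[OF mono z(1)])
  have M: "S k \<in> borel_measurable M" "z k \<in> borel_measurable M" for k
    using measurable_from_subalg[OF sub] S_meas z(1) by blast+
  have "integrable M (\<lambda>\<omega>. (S n \<omega>)\<^sup>2) \<and>
    expectation (\<lambda>\<omega>. (S n \<omega>)\<^sup>2) = (\<Sum>i<n. expectation (\<lambda>\<omega>. (z i \<omega>)\<^sup>2))"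
  proof (induction n)
    case 0
    show ?case by (simp add: S_def)
  next
    case (Suc k)
    have S: "S (Suc k) = (\<lambda>\<omega>. S k \<omega> + z k \<omega>)" by (simp add: S_def fun_eq_iff)
    have int: "integrable M (\<lambda>\<omega>. (S (Suc k) \<omega>)\<^sup>2)"
      unfolding S using Suc z(2) M by (intro integrable_add_square) auto
    have cross: "integrable M (\<lambda>\<omega>. S k \<omega> * z k \<omega>)"
      using Suc z(2) M by (intro integrable_mult_square_integrable) auto
    have "expectation (\<lambda>\<omega>. (S (Suc k) \<omega>)\<^sup>2) =
      expectation (\<lambda>\<omega>. (S k \<omega>)\<^sup>2 + (z k \<omega>)\<^sup>2 + 2 * (S k \<omega> * z k \<omega>))"
      by (simp add: S power2_sum mult.assoc)
    also have "\<dots> = expectation (\<lambda>\<omega>. (S k \<omega>)\<^sup>2) + expectation (\<lambda>\<omega>. (z k \<omega>)\<^sup>2)"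
      using Suc z(2) cross orth[OF S_meas[of k]] by simp
    finally show ?case using Suc int by simp
  qed
  then show "integrable M (\<lambda>\<omega>. (\<Sum>i<n. z i \<omega>)\<^sup>2)"
    and "expectation (\<lambda>\<omega>. (\<Sum>i<n. z i \<omega>)\<^sup>2) = (\<Sum>i<n. expectation (\<lambda>\<omega>. (z i \<omega>)\<^sup>2))"
    by (simp_all add: S_def)
qed

section \<open>The tail of a single centred variable\<close>

text \<open>Adding both tails would cost \<open>2 * I\<close>, so the cases use one each. If
  \<open>v \<le> x\<close>, the event lies in the right tail. If \<open>v > x\<close>, either the
  exponential alone dominates, or the event is so likely that centring forces
  \<open>I \<ge> 1\<close> through the left tail.\<close>

lemma (in prob_space) one_step_bound:
  fixes X :: "'a \<Rightarrow> real"
  assumes int_X: "integrable M X" and mean: "expectation X = 0"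
    and x: "2 \<le> x" and v: "0 < v"
    and up: "integrable M (\<lambda>\<omega>. if v < X \<omega> then (X \<omega>)\<^sup>2 else 0)"
      "expectation (\<lambda>\<omega>. if v < X \<omega> then (X \<omega>)\<^sup>2 else 0) \<le> I"
    and down: "integrable M (\<lambda>\<omega>. if v < - X \<omega> then (- X \<omega>)\<^sup>2 else 0)"
      "expectation (\<lambda>\<omega>. if v < - X \<omega> then (- X \<omega>)\<^sup>2 else 0) \<le> I"
  shows "prob {\<omega> \<in> space M. x < X \<omega>} \<le> exp (- (x\<^sup>2 / (8 * v\<^sup>2))) + I"
proof -
  have [measurable]: "X \<in> borel_measurable M" using int_X by simp
  define A p where "A = {\<omega> \<in> space M. x < X \<omega>}" and "p = prob A"
  have A [measurable]: "A \<in> sets M" by (simp add: A_def)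
  have int_A: "integrable M (indicator A :: 'a \<Rightarrow> real)"
    by (rule integrable_const_bound[where B = 1]) auto
  have p: "expectation (indicator A) = p" by (simp add: p_def)
  have p1: "p \<le> 1" by (simp add: p_def)
  have p0: "0 \<le> p" by (simp add: p_def)
  have I: "0 \<le> I"
    by (rule order_trans[OF Bochner_Integration.integral_nonneg up(2)]) auto
  have "p \<le> exp (- (x\<^sup>2 / (8 * v\<^sup>2))) + I"
  proof (cases "v \<le> x")
    case True
    \<comment> \<open>Chebyshev on the right tail, as \<open>v \<le> x < X \<omega>\<close> on
      \<open>A\<close>; the factor \<open>x\<^sup>2 \<ge> 1\<close> is dropped afterwards.\<close>
    have "p * x\<^sup>2 = expectation (\<lambda>\<omega>. indicator A \<omega> * x\<^sup>2)"
      using p by simp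
    also have "\<dots> \<le> expectation (\<lambda>\<omega>. if v < X \<omega> then (X \<omega>)\<^sup>2 else 0)"
    proof (rule integral_mono)
      show "indicator A \<omega> * x\<^sup>2 \<le> (if v < X \<omega> then (X \<omega>)\<^sup>2 else 0)" for \<omega>
        using True x by (auto simp: A_def split: split_indicator intro!: power_mono)
    qed (use int_A up in auto)
    finally have "p * x\<^sup>2 \<le> I" using up(2) by linarith
    moreover have "1 \<le> x\<^sup>2" using x by (simp add: one_le_power)
    then have "p * 1 \<le> p * x\<^sup>2" using p0 by (rule mult_left_mono)
    ultimately show ?thesis by (simp add: add_increasing)
  next
    case False
    define r where "r = x / v"
    have r: "0 < r" "r < 1" using False x v by (auto simp: r_def)
    have xr: "x = r * v" using v by (simp add: r_def)
    \<comment> \<open>From \<open>1 + u \<le> exp u\<close> at \<open>u = - r\<^sup>2 / 8\<close>.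
      This leaves \<open>p > 1 - r\<^sup>2 / 8\<close> as the case to treat.\<close>
    have e: "1 - r\<^sup>2 / 8 \<le> exp (- (x\<^sup>2 / (8 * v\<^sup>2)))"
      using exp_ge_add_one_self[of "- (x\<^sup>2 / (8 * v\<^sup>2))"] by (simp add: r_def power_divide)
    show ?thesis
    proof (cases "p \<le> 1 - r\<^sup>2 / 8")
      case True
      then show ?thesis using e I by linarith
    next
      case notle: False
      have r2: "r\<^sup>2 < 1" using r by (simp add: power_less_one_iff)
      let ?d = "\<lambda>\<omega>. if v < - X \<omega> then (- X \<omega>)\<^sup>2 else 0"
      \<comment> \<open>Adding \<open>?d \<omega> / v\<close> lifts \<open>X\<close> to at least
        \<open>- v\<close>, since \<open>(X \<omega>)\<^sup>2 / v \<ge> - X \<omega>\<close> where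
        \<open>- X \<omega> > v\<close>; on \<open>A\<close> the value is at least \<open>x\<close>.
        Integration then uses that \<open>X\<close> is centred.\<close>
      have "expectation (\<lambda>\<omega>. indicator A \<omega> * (x + v) - v) \<le> expectation (\<lambda>\<omega>. X \<omega> + ?d \<omega> / v)"
      proof (rule integral_mono)
        fix \<omega> assume \<omega>: "\<omega> \<in> space M"
        have "- v \<le> X \<omega> + ?d \<omega> / v"
        proof (cases "v < - X \<omega>")
          case True
          then have "v * (- X \<omega>) \<le> (- X \<omega>) * (- X \<omega>)"
            using v by (intro mult_right_mono) auto
          then have "- X \<omega> \<le> (- X \<omega>)\<^sup>2 / v"
            using v by (simp add: field_simps power2_eq_square)
          then show ?thesis using True v by simp
        qed auto
        moreover have "x \<le> X \<omega> + ?d \<omega> / v" if "\<omega> \<in> A"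
          using that v x by (auto simp: A_def)
        ultimately show "indicator A \<omega> * (x + v) - v \<le> X \<omega> + ?d \<omega> / v"
          by (auto split: split_indicator)
      qed (use int_A int_X down(1) in auto)
      also have "\<dots> = expectation ?d / v"
        using int_X down(1) mean by simp
      also have "\<dots> \<le> I / v"
        using down(2) v by (intro divide_right_mono) auto
      also have "expectation (\<lambda>\<omega>. indicator A \<omega> * (x + v) - v) = p * (x + v) - v"
        using int_A p by (simp add: prob_space)
      finally have "p * (x + v) - v \<le> I / v" .
      then have "v * (p * (x + v) - v) \<le> I"
        using v by (simp add: field_simps)
      \<comment> \<open>As \<open>x = r * v\<close> and \<open>r < 1\<close>, the second factor is
        at least \<open>x * (1 - r\<^sup>2 / 8 - r / 8)\<close>, where the bracket exceeds
        \<open>3 / 4\<close>; so \<open>x \<ge> 2\<close> lifts it above \<open>1\<close>, and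
        \<open>v > x\<close> does the same for the first.\<close>
      moreover have "1 \<le> v * (p * (x + v) - v)"
      proof -
        have "(1 - r\<^sup>2 / 8) * (x + v) \<le> p * (x + v)"
          using notle x v by (intro mult_right_mono) auto
        moreover have "(1 - r\<^sup>2 / 8) * (x + v) - v = x * (1 - r\<^sup>2 / 8 - r / 8)"
          using xr by (simp add: algebra_simps power2_eq_square)
        moreover have "x * (1 / 2) \<le> x * (1 - r\<^sup>2 / 8 - r / 8)"
          using r r2 x by (intro mult_left_mono) auto
        ultimately have "1 \<le> p * (x + v) - v" using x by linarith
        moreover have "1 \<le> v" using False x by linarith
        ultimately show ?thesis
          using mult_mono[of 1 v 1 "p * (x + v) - v"] by simp
      qed
      ultimately have "p \<le> I" using p1 by linarith
      then show ?thesis by (simp add: add_increasing)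
    qed
  qed
  then show ?thesis by (simp add: p_def A_def)
qed

section \<open>Truncation of the differences at the level \<open>v\<close>\<close>

text \<open>\<open>Y i\<close> is split as \<open>(a i - c i) + (b i + c i)\<close>, where
  \<open>a i\<close> is the part within the level, \<open>b i\<close> the part beyond it and
  \<open>c i\<close> the conditional mean of \<open>a i\<close>. The constant \<open>J\<close>
  accounts for both tails together.\<close>

lemma (in prob_space) martingale_truncation_bound:
  fixes Y :: "nat \<Rightarrow> 'a \<Rightarrow> real"
  assumes sub: "\<And>i. subalgebra M (F i)" and mono: "\<And>i j. i \<le> j \<Longrightarrow> subalgebra (F j) (F i)"
    and Y: "\<And>i. Y i \<in> borel_measurable (F (Suc i))"
    and orth: "\<And>i f. f \<in> borel_measurable (F i) \<Longrightarrow> integrable M (\<lambda>\<omega>. f \<omega> * Y i \<omega>) \<Longrightarrow>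
      expectation (\<lambda>\<omega>. f \<omega> * Y i \<omega>) = 0"
    and v: "0 < v" and x: "0 < x" and n: "0 < n"
    and tail: "\<And>i. integrable M (\<lambda>\<omega>. if v < \<bar>Y i \<omega>\<bar> then (Y i \<omega>)\<^sup>2 else 0)"
      "\<And>i. expectation (\<lambda>\<omega>. if v < \<bar>Y i \<omega>\<bar> then (Y i \<omega>)\<^sup>2 else 0) \<le> J"
  shows "prob {\<omega> \<in> space M. real n * x < (\<Sum>i<n. Y i \<omega>)}
    \<le> exp (- (real n * x\<^sup>2 / (8 * v\<^sup>2))) + 4 * J / (real n * x\<^sup>2)"
proof -
  define a b where "a i \<omega> = (if v < \<bar>Y i \<omega>\<bar> then 0 else Y i \<omega>)"
    and "b i \<omega> = (if v < \<bar>Y i \<omega>\<bar> then Y i \<omega> else 0)" for i \<omega>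
  have ab: "Y i \<omega> = a i \<omega> + b i \<omega>" for i \<omega> by (simp add: a_def b_def)
  have aF: "a i \<in> borel_measurable (F (Suc i))" and bF: "b i \<in> borel_measurable (F (Suc i))" for i
    using Y[of i] unfolding a_def b_def by measurable
  have a_le: "\<bar>a i \<omega>\<bar> \<le> v" for i \<omega> using v by (simp add: a_def)
  have M [measurable]: "Y i \<in> borel_measurable M" "a i \<in> borel_measurable M" "b i \<in> borel_measurable M" for i
    using measurable_from_subalg[OF sub] Y aF bF by blast+
  have "\<forall>i. \<exists>c. c \<in> borel_measurable (F i) \<and> (\<forall>\<omega>. \<bar>c \<omega>\<bar> \<le> v) \<and>
    (\<forall>f. f \<in> borel_measurable (F i) \<longrightarrow> integrable M f \<longrightarrow>
      expectation (\<lambda>\<omega>. f \<omega> * a i \<omega>) = expectation (\<lambda>\<omega>. f \<omega> * c \<omega>))"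
    using bounded_cond_exp_version[OF sub M(2) a_le] by metis
  then obtain c where cF: "\<And>i. c i \<in> borel_measurable (F i)" and c_le: "\<And>i \<omega>. \<bar>c i \<omega>\<bar> \<le> v"
    and comp: "\<And>i f. f \<in> borel_measurable (F i) \<Longrightarrow> integrable M f \<Longrightarrow>
      expectation (\<lambda>\<omega>. f \<omega> * a i \<omega>) = expectation (\<lambda>\<omega>. f \<omega> * c i \<omega>)"
    by metis
  have [measurable]: "c i \<in> borel_measurable M" for i
    using measurable_from_subalg[OF sub cF] .
  \<comment> \<open>Since \<open>Y i\<close> has conditional mean zero, \<open>c i\<close> is almost
    everywhere minus the conditional mean of \<open>b i\<close>: thus \<open>z i\<close> is the
    centred large part.\<close>
  define z where "z i \<omega> = b i \<omega> + c i \<omega>" for i \<omega>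
  have [measurable]: "z i \<in> borel_measurable M" for i
    unfolding z_def by measurable
  have zF: "z i \<in> borel_measurable (F (Suc i))" for i
    using bF[of i] measurable_from_subalg[OF mono cF, of i "Suc i"]
    unfolding z_def by (intro borel_measurable_add) auto
  have bounded_sq: "integrable M (\<lambda>\<omega>. (y \<omega>)\<^sup>2)"
    if "y \<in> borel_measurable M" "\<And>\<omega>. \<bar>y \<omega>\<bar> \<le> v" for y
    by (rule integrable_const_bound[where B = "v\<^sup>2"])
       (use that v in \<open>auto simp: abs_le_square_iff[symmetric]\<close>)
  have a2: "integrable M (\<lambda>\<omega>. (a i \<omega>)\<^sup>2)" and c2: "integrable M (\<lambda>\<omega>. (c i \<omega>)\<^sup>2)" for i
    using a_le c_le by (auto intro: bounded_sq)
  have b2_eq: "(b i \<omega>)\<^sup>2 = (if v < \<bar>Y i \<omega>\<bar> then (Y i \<omega>)\<^sup>2 else 0)" for i \<omega>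
    by (simp add: b_def)
  have b2: "integrable M (\<lambda>\<omega>. (b i \<omega>)\<^sup>2)" and b2_le: "expectation (\<lambda>\<omega>. (b i \<omega>)\<^sup>2) \<le> J" for i
    using tail[of i] by (simp_all add: b2_eq)
  have Y2: "integrable M (\<lambda>\<omega>. (Y i \<omega>)\<^sup>2)" for i
    unfolding ab by (intro integrable_add_square a2 b2) auto
  have z2: "integrable M (\<lambda>\<omega>. (z i \<omega>)\<^sup>2)" for i
    unfolding z_def by (intro integrable_add_square b2 c2) auto
  have z_orth: "expectation (\<lambda>\<omega>. f \<omega> * z i \<omega>) = 0"
    if f: "f \<in> borel_measurable (F i)" and f2: "integrable M (\<lambda>\<omega>. (f \<omega>)\<^sup>2)" for i f
  proof -
    have fM [measurable]: "f \<in> borel_measurable M"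
      using measurable_from_subalg[OF sub f] .
    note prod = integrable_mult_square_integrable[OF fM _ f2]
    have "integrable M f"
      using prod[of "\<lambda>_. 1"] by simp
    \<comment> \<open>\<open>z i = Y i - a i + c i\<close>: the first term is orthogonal to the
      past, and the other two cancel by \<open>comp\<close>.\<close>
    have "expectation (\<lambda>\<omega>. f \<omega> * z i \<omega>)
        = expectation (\<lambda>\<omega>. f \<omega> * Y i \<omega> - f \<omega> * a i \<omega> + f \<omega> * c i \<omega>)"
      by (intro Bochner_Integration.integral_cong) (auto simp: z_def ab algebra_simps)
    also have "\<dots> = 0"
      using comp[OF f \<open>integrable M f\<close>] orth[OF f] prod[OF _ Y2] prod[OF _ a2] prod[OF _ c2]
      by simp
    finally show ?thesis .
  qed
  have z2_le: "expectation (\<lambda>\<omega>. (z i \<omega>)\<^sup>2) \<le> J" for i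
  proof -
    have cz: "integrable M (\<lambda>\<omega>. c i \<omega> * z i \<omega>)"
      by (intro integrable_mult_square_integrable c2 z2) auto
    \<comment> \<open>Centring does not increase the second moment:
      \<open>z\<^sup>2 = b\<^sup>2 + 2 * c * z - c\<^sup>2\<close>, and \<open>c i\<close> is
      orthogonal to \<open>z i\<close>.\<close>
    have "expectation (\<lambda>\<omega>. (z i \<omega>)\<^sup>2) \<le> expectation (\<lambda>\<omega>. (b i \<omega>)\<^sup>2 + 2 * (c i \<omega> * z i \<omega>))"
    proof (rule integral_mono[OF z2])
      fix \<omega>
      show "(z i \<omega>)\<^sup>2 \<le> (b i \<omega>)\<^sup>2 + 2 * (c i \<omega> * z i \<omega>)"
        using zero_le_power2[of "c i \<omega>"] unfolding z_def power2_eq_square by (simp add: algebra_simps)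
    qed (use b2 cz in auto)
    also have "\<dots> = expectation (\<lambda>\<omega>. (b i \<omega>)\<^sup>2)"
      using b2 cz z_orth[OF cF c2] by simp
    finally show ?thesis using b2_le[of i] by linarith
  qed
  \<comment> \<open>The minimizer in \<open>l\<close> of
    \<open>real n * (l\<^sup>2 * v\<^sup>2 / 2) - l * h\<close>, where
    \<open>h = real n * x / 2\<close> is the half of the deviation allotted to each of
    \<open>D\<close> and \<open>Z\<close>.\<close>
  define l where "l = x / (2 * v\<^sup>2)"
  have l: "0 < l" using x v by (simp add: l_def)
  define D Z where "D \<omega> = (\<Sum>i<n. a i \<omega> - c i \<omega>)" and "Z \<omega> = (\<Sum>i<n. z i \<omega>)" for \<omega>
  have [measurable]: "D \<in> borel_measurable M" "Z \<in> borel_measurable M"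
    unfolding D_def Z_def by measurable
  have sum: "(\<Sum>i<n. Y i \<omega>) = D \<omega> + Z \<omega>" for \<omega>
    by (simp add: D_def Z_def z_def ab sum.distrib sum_subtractf)
  define h where "h = real n * x / 2"
  have h: "0 < h" using n x by (simp add: h_def)
  have "prob {\<omega> \<in> space M. h \<le> D \<omega>} = prob {\<omega> \<in> space M. exp (l * h) \<le> exp (l * D \<omega>)}"
    using l by simp
  also have "\<dots> \<le> expectation (\<lambda>\<omega>. exp (l * D \<omega>)) / exp (l * h)"
    using exp_moment_compensated_sum_le(1)[of F v l a c n] sub mono v l aF a_le cF c_le comp
    unfolding D_def[symmetric] by (intro integral_Markov_inequality_measure[where A = "{}"]) auto
  also have "\<dots> \<le> exp (real n * (l\<^sup>2 * v\<^sup>2 / 2)) / exp (l * h)"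
    using exp_moment_compensated_sum_le(2)[of F v l a c n] sub mono v l aF a_le cF c_le comp
    unfolding D_def[symmetric] by (intro divide_right_mono) auto
  also have "\<dots> = exp (- (real n * x\<^sup>2 / (8 * v\<^sup>2)))"
  proof -
    have "real n * (l\<^sup>2 * v\<^sup>2 / 2) - l * h = - (real n * x\<^sup>2 / (8 * v\<^sup>2))"
      using v by (simp add: l_def h_def field_simps power2_eq_square)
    then show ?thesis by (simp flip: exp_diff)
  qed
  finally have D_le: "prob {\<omega> \<in> space M. h \<le> D \<omega>} \<le> exp (- (real n * x\<^sup>2 / (8 * v\<^sup>2)))" .
  note Z2 = second_moment_martingale_sum[of F z n, OF sub mono zF z2 z_orth, folded Z_def]
  have "prob {\<omega> \<in> space M. h \<le> Z \<omega>} \<le> prob {\<omega> \<in> space M. h\<^sup>2 \<le> (Z \<omega>)\<^sup>2}"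
    using h by (intro finite_measure_mono) (auto intro: power_mono)
  also have "\<dots> \<le> expectation (\<lambda>\<omega>. (Z \<omega>)\<^sup>2) / h\<^sup>2"
    using h Z2(1) by (intro integral_Markov_inequality_measure[where A = "{}"]) auto
  \<comment> \<open>By orthogonality the second moments add up, so the numerator is linear in
    \<open>n\<close> against the quadratic \<open>h\<^sup>2\<close>.\<close>
  also have "\<dots> \<le> (real n * J) / h\<^sup>2"
    using sum_bounded_above[of "{..<n}" "\<lambda>i. expectation (\<lambda>\<omega>. (z i \<omega>)\<^sup>2)" J] z2_le
    by (intro divide_right_mono) (auto simp: Z2(2))
  also have "\<dots> = 4 * J / (real n * x\<^sup>2)"
    using n x by (simp add: h_def power2_eq_square mult_ac)
  finally have Z_le: "prob {\<omega> \<in> space M. h \<le> Z \<omega>} \<le> 4 * J / (real n * x\<^sup>2)" .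
  have "prob {\<omega> \<in> space M. real n * x < (\<Sum>i<n. Y i \<omega>)}
      \<le> prob ({\<omega> \<in> space M. h \<le> D \<omega>} \<union> {\<omega> \<in> space M. h \<le> Z \<omega>})"
  proof (rule finite_measure_mono)
    have "h \<le> D \<omega> \<or> h \<le> Z \<omega>" if "real n * x < D \<omega> + Z \<omega>" for \<omega>
      using that unfolding h_def by linarith
    then show "{\<omega> \<in> space M. real n * x < (\<Sum>i<n. Y i \<omega>)}
        \<subseteq> {\<omega> \<in> space M. h \<le> D \<omega>} \<union> {\<omega> \<in> space M. h \<le> Z \<omega>}"
      unfolding sum by auto
  qed measurable
  also have "\<dots> \<le> prob {\<omega> \<in> space M. h \<le> D \<omega>} + prob {\<omega> \<in> space M. h \<le> Z \<omega>}"
    by (rule measure_Un_le) measurable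
  finally show ?thesis using D_le Z_le by linarith
qed

section \<open>The bound for each truncation level, and the infimum over levels\<close>

theorem theorem2p1:
  fixes M :: "'a measure"
    and F :: "nat \<Rightarrow> 'a measure"
    and \<xi> :: "nat \<Rightarrow> 'a \<Rightarrow> real"
    and T :: "real \<Rightarrow> real"
    and n :: nat
    and x :: real
  assumes "prob_space M"
    and "martingale_differences M F \<xi>"
    and "tail_function T"
    and "finite_second_moment T"
    and "\<And>i y. i \<ge> 1 \<Longrightarrow> y \<ge> 0 \<Longrightarrow> tail_of M (\<xi> i) y \<le> T y"
    and "n \<ge> 1"
    and "x \<ge> 2"
  shows "Q M \<xi> n x \<le> W T (x * sqrt (real n))"
proof -
  interpret prob_space M by fact
  note diff = assms(2)[unfolded martingale_differences_def]
  have sub: "subalgebra M (F i)" for i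
    using diff by blast
  have mono: "subalgebra (F j) (F i)" if "i \<le> j" for i j
    using that diff filtration.sets_F_mono[of "space M" F i j] filtration.space_F[of "space M" F]
    by (simp add: subalgebra_def)
  \<comment> \<open>The shift makes \<open>Y i\<close> known at time \<open>i + 1\<close> and
    centred given \<open>F i\<close>, and turns the sum from \<open>1\<close> to \<open>n\<close>
    into one over \<open>i < n\<close>.\<close>
  define Y where "Y i = \<xi> (Suc i)" for i
  have YF: "Y i \<in> borel_measurable (F (Suc i))" and Y_int: "integrable M (Y i)"
    and Y_mean: "expectation (Y i) = 0" for i
    using diff unfolding Y_def by auto
  have YM [measurable]: "Y i \<in> borel_measurable M" for i
    using Y_int by simp
  have orth: "expectation (\<lambda>\<omega>. f \<omega> * Y i \<omega>) = 0"
    if f: "f \<in> borel_measurable (F i)" and fY: "integrable M (\<lambda>\<omega>. f \<omega> * Y i \<omega>)" for i f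
  proof -
    interpret finite_measure_subalgebra M "F i"
      by unfold_locales (rule sub)
    have fM [measurable]: "f \<in> borel_measurable M"
      using measurable_from_subalg[OF sub f] .
    have ae: "AE \<omega> in M. real_cond_exp M (F i) (Y i) \<omega> = 0"
      using diff unfolding Y_def by auto
    have "expectation (\<lambda>\<omega>. f \<omega> * Y i \<omega>)
        = expectation (\<lambda>\<omega>. f \<omega> * real_cond_exp M (F i) (Y i) \<omega>)"
      using real_cond_exp_intg(2)[OF fY f YM] by simp
    also have "\<dots> = expectation (\<lambda>\<omega>. 0)"
      by (intro integral_cong_AE) (use ae in auto)
    finally show ?thesis by simp
  qed
  have partial: "partial_sum \<xi> n \<omega> = (\<Sum>i<n. Y i \<omega>)" for \<omega>
    unfolding partial_sum_def Y_def by (simp add: sum.atLeast1_atMost_eq)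
  have Q_eq: "Q M \<xi> n x = prob {\<omega> \<in> space M. real n * x < (\<Sum>i<n. Y i \<omega>)}"
    using \<open>n \<ge> 1\<close> by (simp add: Q_def partial field_simps)
  have bound: "Q M \<xi> n x \<le> exp (- ((x * sqrt (real n))\<^sup>2 / (8 * v\<^sup>2))) + (LINT y:{v<..}|abs_dT T. y\<^sup>2)"
    if v: "0 < v" for v
  proof -
    define I where "I = (LINT y:{v<..}|abs_dT T. y\<^sup>2)"
    have tails: "prob {\<omega> \<in> space M. Y i \<omega> \<ge> y} \<le> T y"
      "prob {\<omega> \<in> space M. - Y i \<omega> \<ge> y} \<le> T y" if "0 \<le> y" for i y
      using assms(5)[of "Suc i" y] that by (simp_all add: tail_of_def Y_def le_minus_iff)
    have up: "integrable M (\<lambda>\<omega>. if v < Y i \<omega> then (Y i \<omega>)\<^sup>2 else 0)"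
      "expectation (\<lambda>\<omega>. if v < Y i \<omega> then (Y i \<omega>)\<^sup>2 else 0) \<le> I" for i
      unfolding I_def by (rule second_moment_tail[OF YM assms(3,4) v]; blast intro: tails)+
    have down: "integrable M (\<lambda>\<omega>. if v < - Y i \<omega> then (- Y i \<omega>)\<^sup>2 else 0)"
      "expectation (\<lambda>\<omega>. if v < - Y i \<omega> then (- Y i \<omega>)\<^sup>2 else 0) \<le> I" for i
      unfolding I_def
      by (rule second_moment_tail[OF borel_measurable_uminus[OF YM] assms(3,4) v]; blast intro: tails)+
    have I: "0 \<le> I"
      unfolding I_def set_lebesgue_integral_def by (intro Bochner_Integration.integral_nonneg) auto
    have sq: "(x * sqrt (real n))\<^sup>2 = real n * x\<^sup>2"
      by (simp add: power_mult_distrib)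
    have "Q M \<xi> n x \<le> exp (- (real n * x\<^sup>2 / (8 * v\<^sup>2))) + I"
    \<comment> \<open>For \<open>n = 1\<close> and \<open>x = 2\<close> the factor
      \<open>4 * 2 / (real n * x\<^sup>2)\<close> of the general estimate equals \<open>2\<close>,
      which is too large; hence the separate one-step bound.\<close>
    proof (cases "n = 1")
      case True
      then show ?thesis
        unfolding Q_eq
        using one_step_bound[OF Y_int Y_mean \<open>x \<ge> 2\<close> v up down, of 0] by simp
    next
      case False
      \<comment> \<open>As \<open>v > 0\<close>, the two tail events are disjoint; each contributes
        at most \<open>I\<close>, whence \<open>2 * I\<close>.\<close>
      have split: "(if v < \<bar>Y i \<omega>\<bar> then (Y i \<omega>)\<^sup>2 else 0) =
        (if v < Y i \<omega> then (Y i \<omega>)\<^sup>2 else 0) + (if v < - Y i \<omega> then (- Y i \<omega>)\<^sup>2 else 0)" for i \<omega>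
        using v by auto
      have "Q M \<xi> n x \<le> exp (- (real n * x\<^sup>2 / (8 * v\<^sup>2))) + 4 * (2 * I) / (real n * x\<^sup>2)"
        unfolding Q_eq
      proof (rule martingale_truncation_bound[where F = F and Y = Y, OF sub mono YF orth v])
        show "integrable M (\<lambda>\<omega>. if v < \<bar>Y i \<omega>\<bar> then (Y i \<omega>)\<^sup>2 else 0)" for i
          unfolding split using up(1) down(1) by (intro Bochner_Integration.integrable_add)
        show "expectation (\<lambda>\<omega>. if v < \<bar>Y i \<omega>\<bar> then (Y i \<omega>)\<^sup>2 else 0) \<le> 2 * I" for i
          unfolding split Bochner_Integration.integral_add[OF up(1) down(1)]
          using up(2)[of i] down(2)[of i] by linarith
      qed (use assms(6,7) in auto)
      also have "4 * (2 * I) / (real n * x\<^sup>2) \<le> I"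
      proof -
        \<comment> \<open>With \<open>n \<ge> 2\<close> and \<open>x \<ge> 2\<close> the denominator
          reaches the \<open>8\<close> that absorbs \<open>4 * 2\<close>.\<close>
        have "2 * 2\<^sup>2 \<le> real n * x\<^sup>2"
          using False assms(6,7) by (intro mult_mono power_mono) auto
        then have "I * 8 \<le> I * (real n * x\<^sup>2)"
          using I by (intro mult_left_mono) auto
        then show ?thesis
          using assms(6,7) by (simp add: divide_le_eq)
      qed
      finally show ?thesis by simp
    qed
    then show ?thesis by (simp only: sq I_def)
  qed
  show ?thesis
    unfolding W_def
  proof (rule min.boundedI)
    show "Q M \<xi> n x \<le> 1" by (simp add: Q_def)
    show "Q M \<xi> n x \<le> (INF v\<in>{0<..}. exp (- ((x * sqrt (real n))\<^sup>2 / (8 * v\<^sup>2)))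
        + (LINT y:{v<..}|abs_dT T. y\<^sup>2))"
      using bound by (intro cINF_greatest) auto
  qed
qed

end
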